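(* Let $A$ be a totally ordered alphabet and $w$ a nonempty finite word over $A$. For each $i\in\{1,\dots,6\}$, the word $w$ is a Lyndon word if and only if condition $(i)$ below holds for every factorization $w=uv$ with $u,v$ nonempty: (1) $u^\omega<v^\omega$; (2) $(uv)^\omega<v^\omega$; (3) $u^\omega<(vu)^\omega$; (4) $(uv)^\omega<(vu)^\omega$; (5) $u^\omega<(uv)^\omega$; (6) $(vu)^\omega<v^\omega$.
   Context: The order $<$ on finite and infinite words is the lexicographical order induced by the order of $A$. For a nonempty finite word $x$, $x^\omega=xxx\cdots$. A nonempty word $w$ is a Lyndon word if for every factorization $w=uv$ with $u,v$ nonempty one has $w<v$ (equivalently $u<v$, equivalently $uv<vu$). *)

theory Defs
  imports
    "HOL-Library.List_Lexorder"
    "HOL-Library.Fun_Lexorder"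
    "HOL-Library.Omega_Words_Fun"
begin

text \<open>
  Finite words are lists, ordered lexicographically by the order instance of List_Lexorder
  (a proper prefix is smaller).  Infinite words are functions on the natural numbers; their
  lexicographic order is \<^const>\<open>less_fun\<close>, and the infinite power of a nonempty word is
  \<^const>\<open>iter\<close>.  Function types already carry the pointwise order under \<open><\<close>, hence the
  separate infix symbol.
\<close>

abbreviation omega_less :: "'a::linorder word \<Rightarrow> 'a word \<Rightarrow> bool"  (infix \<open><\<^sub>\<omega>\<close> 50)
  where "x <\<^sub>\<omega> y \<equiv> less_fun x y"

definition Lyndon :: "'a::linorder list \<Rightarrow> bool"
  where "Lyndon w \<longleftrightarrow> w \<noteq> [] \<and> (\<forall>u v. u \<noteq> [] \<and> v \<noteq> [] \<and> w = u @ v \<longrightarrow> w < v)"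

end

theory Submission
  imports Defs
begin

text \<open>
  Every condition compares the infinite powers of two words whose comparison reduces to
  \<open>u @ v < v @ u\<close>.  Indeed \<open>x\<^sup>\<omega> <\<^sub>\<omega> y\<^sup>\<omega>\<close> iff
  \<open>x @ y < y @ x\<close>: from \<open>x @ y < y @ x\<close> one gets
  \<open>x \<frown> c <\<^sub>\<omega> c\<close> for \<open>c = y \<frown> x\<^sup>\<omega>\<close>, and \<open>x\<^sup>\<omega>\<close> compares with any
  infinite word \<open>c\<close> as \<open>x \<frown> c\<close> does, so
  \<open>x\<^sup>\<omega> <\<^sub>\<omega> y \<frown> x\<^sup>\<omega>\<close>, whence \<open>x\<^sup>\<omega> <\<^sub>\<omega> y\<^sup>\<omega>\<close>.
  Cancelling common prefixes and suffixes then settles the six cases at once.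
\<close>

lemma append_less_append_iff:
  fixes x y :: "'a::linorder list"
  assumes "length x = length y"
  shows "x @ s < y @ t \<longleftrightarrow> x < y \<or> x = y \<and> s < t"
  using assms by (induction x y rule: list_induct2) auto

text \<open>In the second case some letter inside both words decides the order, so extending the
  smaller word changes nothing; only a prefix is sensitive to what follows it.\<close>

lemma less_cases_prefix:
  fixes x y :: "'a::linorder list"
  assumes "x < y"
  obtains (prefix) z where "y = x @ z" | (mismatch) "\<And>t. x @ t < y"
proof -
  have "(\<exists>z. y = x @ z) \<or> (\<forall>t. x @ t < y)"
    using assms
  proof (induction x arbitrary: y)
    case (Cons a x)
    then show ?case by (cases y) auto
  qed simp
  then show thesis using that by blast
qed

lemma less_le_append:
  fixes x y :: "'a::linorder list"
  shows "x < y \<Longrightarrow> x < y @ t"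
proof (induction x arbitrary: y)
  case Nil
  then show ?case by (cases y) auto
next
  case (Cons a x)
  then show ?case by (cases y) auto
qed

text \<open>Equal lengths exclude the prefix case, so a letter inside \<open>x\<close> and
  \<open>y\<close> decides before the tails are reached.\<close>

lemma less_imp_conc_omega_less:
  fixes x y :: "'a::linorder list"
  assumes "length x = length y" "x < y"
  shows "x \<frown> s <\<^sub>\<omega> y \<frown> t"
  using assms
proof (induction x y rule: list_induct2)
  case (Cons a x b y)
  show ?case
  proof (cases "a < b")
    case True
    then show ?thesis
      unfolding less_fun_def by (intro exI[of _ 0]) simp
  next
    case False
    with Cons.prems have "a = b" "x < y" by simp_all
    with Cons.IH have "x \<frown> s <\<^sub>\<omega> y \<frown> t" by blast
    then obtain k where k: "(x \<frown> s) k < (y \<frown> t) k" "\<And>i. i < k \<Longrightarrow> (x \<frown> s) i = (y \<frown> t) i"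
      unfolding less_fun_def by blast
    have "((a # x) \<frown> s) i = ((b # y) \<frown> t) i" if "i < Suc k" for i
      using that k(2) \<open>a = b\<close> by (cases i) simp_all
    with k(1) show ?thesis
      unfolding less_fun_def by (intro exI[of _ "Suc k"]) simp
  qed
qed simp

text \<open>Beyond the first block, \<open>u \<frown> c\<close> at \<open>i\<close> reads
  \<open>c\<close> at \<open>i - length u\<close>, a position where \<open>c\<close> is already
  known to follow \<open>u\<^sup>\<omega>\<close>. That position is strictly below \<open>k\<close>
  even for \<open>i = k\<close>, so the bound \<open>k\<close> itself is included.\<close>

lemma iter_eq_conc_upto:
  assumes "u \<noteq> []" and "\<And>i. i < k \<Longrightarrow> c i = (u \<frown> c) i" and "i \<le> k"
  shows "u\<^sup>\<omega> i = (u \<frown> c) i"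
  using \<open>i \<le> k\<close>
proof (induction i rule: less_induct)
  case (less i)
  show ?case
  proof (cases "i < length u")
    case False
    then have "i - length u < i" using \<open>u \<noteq> []\<close> by (cases u) auto
    then have "u\<^sup>\<omega> (i - length u) = c (i - length u)"
      using less assms(2) by simp
    then show ?thesis
      using False \<open>u \<noteq> []\<close> by (subst iter_unroll) simp_all
  qed (use \<open>u \<noteq> []\<close> in simp)
qed

lemma iter_omega_less:
  assumes "u \<noteq> []" and "u \<frown> c <\<^sub>\<omega> c"
  shows "u\<^sup>\<omega> <\<^sub>\<omega> c"
proof -
  obtain k where k: "(u \<frown> c) k < c k" "\<And>i. i < k \<Longrightarrow> c i = (u \<frown> c) i"
    using less_funE[OF assms(2)] by metis
  \<comment> \<open>Thus the first difference between \<open>u \<frown> c\<close> and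
    \<open>c\<close> is also the first one between \<open>u\<^sup>\<omega>\<close> and
    \<open>c\<close>, with the same letters.\<close>
  have eq: "u\<^sup>\<omega> i = (u \<frown> c) i" if "i \<le> k" for i
    using iter_eq_conc_upto[OF assms(1) k(2) that] .
  show ?thesis
    unfolding less_fun_def using k eq by (metis less_imp_le order_refl)
qed

lemma omega_less_iter:
  assumes "u \<noteq> []" and "c <\<^sub>\<omega> u \<frown> c"
  shows "c <\<^sub>\<omega> u\<^sup>\<omega>"
proof -
  obtain k where k: "c k < (u \<frown> c) k" "\<And>i. i < k \<Longrightarrow> c i = (u \<frown> c) i"
    using less_funE[OF assms(2)] by metis
  have eq: "u\<^sup>\<omega> i = (u \<frown> c) i" if "i \<le> k" for i
    using iter_eq_conc_upto[OF assms(1) k(2) that] .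
  show ?thesis
    unfolding less_fun_def using k eq by (metis less_imp_le order_refl)
qed

lemma iter_unique:
  assumes "u \<noteq> []" and "u \<frown> c = c"
  shows "c = u\<^sup>\<omega>"
proof
  fix i
  show "c i = u\<^sup>\<omega> i"
    using iter_eq_conc_upto[of u i c i] assms by simp
qed

lemma conc_conc_iter:
  assumes "u \<noteq> []"
  shows "(v @ u) \<frown> u\<^sup>\<omega> = v \<frown> u\<^sup>\<omega>"
  using iter_unroll[of u] assms by (metis conc_conc length_greater_0_conv)

lemma iter_omega_less_iter:
  fixes u v :: "'a::linorder list"
  assumes "u \<noteq> []" "v \<noteq> []" "u @ v < v @ u"
  shows "u\<^sup>\<omega> <\<^sub>\<omega> v\<^sup>\<omega>"
proof -
  have "(u @ v) \<frown> u\<^sup>\<omega> <\<^sub>\<omega> (v @ u) \<frown> u\<^sup>\<omega>"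
    by (rule less_imp_conc_omega_less) (use assms in simp_all)
  then have "u \<frown> v \<frown> u\<^sup>\<omega> <\<^sub>\<omega> v \<frown> u\<^sup>\<omega>"
    using conc_conc_iter[OF assms(1), of v] by simp
  \<comment> \<open>The first rule is used with \<open>c = v \<frown> u\<^sup>\<omega>\<close>, the
    second with \<open>u\<^sup>\<omega>\<close> as \<open>c\<close> and \<open>v\<close> as the
    period.\<close>
  then show ?thesis
    using iter_omega_less omega_less_iter assms by blast
qed

text \<open>Commutation makes \<open>v \<frown> u\<^sup>\<omega>\<close> a fixed point of prepending
  \<open>u\<close>, hence equal to \<open>u\<^sup>\<omega>\<close>, which is then a fixed point of
  prepending \<open>v\<close>.\<close>

lemma iter_eq_iter_commute:
  assumes "u \<noteq> []" "v \<noteq> []" "u @ v = v @ u"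
  shows "u\<^sup>\<omega> = v\<^sup>\<omega>"
proof -
  have "u \<frown> v \<frown> u\<^sup>\<omega> = v \<frown> u\<^sup>\<omega>"
    using conc_conc_iter[OF assms(1), of v] assms(3) by simp
  then have "v \<frown> u\<^sup>\<omega> = u\<^sup>\<omega>"
    using iter_unique assms(1) by blast
  then show ?thesis
    using iter_unique assms(2) by blast
qed

text \<open>The converse comes from trichotomy: the other two outcomes for \<open>u @ v\<close> and
  \<open>v @ u\<close> force equality or the reverse order of the infinite powers.\<close>

lemma iter_omega_less_iff:
  fixes u v :: "'a::linorder list"
  assumes "u \<noteq> []" "v \<noteq> []"
  shows "u\<^sup>\<omega> <\<^sub>\<omega> v\<^sup>\<omega> \<longleftrightarrow> u @ v < v @ u"
proof (cases "u @ v" "v @ u" rule: linorder_cases)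
  case less
  then show ?thesis using iter_omega_less_iter[of u v] assms by simp
next
  case equal
  then show ?thesis using iter_eq_iter_commute[of u v] assms less_fun_irrefl by fastforce
next
  case greater
  then show ?thesis using iter_omega_less_iter[of v u] assms less_fun_asym by fastforce
qed

lemma Lyndon_iff_rotation:
  fixes w :: "'a::linorder list"
  assumes "w \<noteq> []"
  shows "Lyndon w \<longleftrightarrow> (\<forall>u v. u \<noteq> [] \<and> v \<noteq> [] \<and> w = u @ v \<longrightarrow> u @ v < v @ u)"
proof
  assume "Lyndon w"
  then show "\<forall>u v. u \<noteq> [] \<and> v \<noteq> [] \<and> w = u @ v \<longrightarrow> u @ v < v @ u"
    by (auto simp: Lyndon_def intro: less_le_append)
next
  assume rot: "\<forall>u v. u \<noteq> [] \<and> v \<noteq> [] \<and> w = u @ v \<longrightarrow> u @ v < v @ u"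
  have "w < v" if uv: "u \<noteq> []" "v \<noteq> []" "w = u @ v" for u v
  proof (rule ccontr)
    assume "\<not> w < v"
    then have "v < w" using uv by (simp add: not_less order.order_iff_strict)
    then show False
    proof (cases rule: less_cases_prefix)
      \<comment> \<open>Here \<open>v\<close> is both a prefix and a suffix of \<open>w\<close>. The
        rotations at \<open>u @ v\<close> and at \<open>v @ z\<close> give opposite comparisons of
        \<open>u\<close> and \<open>z\<close>.\<close>
      case (prefix z)
      then have len: "length z = length u" using uv by (metis add.commute add_right_imp_eq length_append)
      have "v @ z < v @ u" using rot uv prefix by auto
      then have "z < u" by (simp add: append_less_append_iff)
      moreover have "u @ v < z @ v"
        using rot uv prefix len by (metis length_0_conv)
      then have "u < z" using len by (simp add: append_less_append_iff)
      ultimately show False by simp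
    next
      case mismatch
      then have "v @ u < w" .
      moreover have "w < v @ u" using rot uv by auto
      ultimately show False by simp
    qed
  qed
  with assms show "Lyndon w" by (auto simp: Lyndon_def)
qed

lemma Lyndon_iff_if_rotation:
  fixes w :: "'a::linorder list"
  assumes "w \<noteq> []"
    and "\<And>u v :: 'a list. u \<noteq> [] \<Longrightarrow> v \<noteq> [] \<Longrightarrow> P u v \<longleftrightarrow> u @ v < v @ u"
  shows "Lyndon w \<longleftrightarrow> (\<forall>u v. u \<noteq> [] \<and> v \<noteq> [] \<and> w = u @ v \<longrightarrow> P u v)"
  unfolding Lyndon_iff_rotation[OF assms(1)] using assms(2) by blast

theorem theorem2:
  fixes w :: "'a::linorder list"
  assumes "w \<noteq> []"
  shows "(Lyndon w \<longleftrightarrow> (\<forall>u v. u \<noteq> [] \<and> v \<noteq> [] \<and> w = u @ v \<longrightarrow> u\<^sup>\<omega> <\<^sub>\<omega> v\<^sup>\<omega>)) \<and>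
         (Lyndon w \<longleftrightarrow> (\<forall>u v. u \<noteq> [] \<and> v \<noteq> [] \<and> w = u @ v \<longrightarrow> (u @ v)\<^sup>\<omega> <\<^sub>\<omega> v\<^sup>\<omega>)) \<and>
         (Lyndon w \<longleftrightarrow> (\<forall>u v. u \<noteq> [] \<and> v \<noteq> [] \<and> w = u @ v \<longrightarrow> u\<^sup>\<omega> <\<^sub>\<omega> (v @ u)\<^sup>\<omega>)) \<and>
         (Lyndon w \<longleftrightarrow> (\<forall>u v. u \<noteq> [] \<and> v \<noteq> [] \<and> w = u @ v \<longrightarrow> (u @ v)\<^sup>\<omega> <\<^sub>\<omega> (v @ u)\<^sup>\<omega>)) \<and>
         (Lyndon w \<longleftrightarrow> (\<forall>u v. u \<noteq> [] \<and> v \<noteq> [] \<and> w = u @ v \<longrightarrow> u\<^sup>\<omega> <\<^sub>\<omega> (u @ v)\<^sup>\<omega>)) \<and>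
         (Lyndon w \<longleftrightarrow> (\<forall>u v. u \<noteq> [] \<and> v \<noteq> [] \<and> w = u @ v \<longrightarrow> (v @ u)\<^sup>\<omega> <\<^sub>\<omega> v\<^sup>\<omega>))"
proof -
  have iffs: "u\<^sup>\<omega> <\<^sub>\<omega> v\<^sup>\<omega> \<longleftrightarrow> u @ v < v @ u"
    "(u @ v)\<^sup>\<omega> <\<^sub>\<omega> v\<^sup>\<omega> \<longleftrightarrow> u @ v < v @ u"
    "u\<^sup>\<omega> <\<^sub>\<omega> (v @ u)\<^sup>\<omega> \<longleftrightarrow> u @ v < v @ u"
    "(u @ v)\<^sup>\<omega> <\<^sub>\<omega> (v @ u)\<^sup>\<omega> \<longleftrightarrow> u @ v < v @ u"
    "u\<^sup>\<omega> <\<^sub>\<omega> (u @ v)\<^sup>\<omega> \<longleftrightarrow> u @ v < v @ u"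
    "(v @ u)\<^sup>\<omega> <\<^sub>\<omega> v\<^sup>\<omega> \<longleftrightarrow> u @ v < v @ u"
    if "u \<noteq> []" "v \<noteq> []" for u v :: "'a list"
  proof -
    have cancel: "x @ s < y @ s \<longleftrightarrow> x < y" if "length x = length y" for x y s :: "'a list"
      using append_less_append_iff[OF that] by simp
    \<comment> \<open>If the leading blocks coincide, so do the trailing ones, hence only the
      leading blocks can decide.\<close>
    have rot: "(u @ v) @ v @ u < (v @ u) @ u @ v \<longleftrightarrow> u @ v < v @ u"
      by (subst append_less_append_iff) auto
    have left: "s @ x < s @ y \<longleftrightarrow> x < y" for x y s :: "'a list"
      using append_less_append_iff[of s s x y] by simp
    show "u\<^sup>\<omega> <\<^sub>\<omega> v\<^sup>\<omega> \<longleftrightarrow> u @ v < v @ u"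
      using iter_omega_less_iff that .
    show "(u @ v)\<^sup>\<omega> <\<^sub>\<omega> v\<^sup>\<omega> \<longleftrightarrow> u @ v < v @ u"
      using iter_omega_less_iff[of "u @ v" v] that cancel[of "u @ v" "v @ u" v] by simp
    show "u\<^sup>\<omega> <\<^sub>\<omega> (v @ u)\<^sup>\<omega> \<longleftrightarrow> u @ v < v @ u"
      using iter_omega_less_iff[of u "v @ u"] that cancel[of "u @ v" "v @ u" u] by simp
    show "(u @ v)\<^sup>\<omega> <\<^sub>\<omega> (v @ u)\<^sup>\<omega> \<longleftrightarrow> u @ v < v @ u"
      using iter_omega_less_iff[of "u @ v" "v @ u"] that rot by simp
    show "u\<^sup>\<omega> <\<^sub>\<omega> (u @ v)\<^sup>\<omega> \<longleftrightarrow> u @ v < v @ u"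
      using iter_omega_less_iff[of u "u @ v"] that left[of u "u @ v" "v @ u"] by simp
    show "(v @ u)\<^sup>\<omega> <\<^sub>\<omega> v\<^sup>\<omega> \<longleftrightarrow> u @ v < v @ u"
      using iter_omega_less_iff[of "v @ u" v] that left[of v "u @ v" "v @ u"] by simp
  qed
  show ?thesis
    by (intro conjI; rule Lyndon_iff_if_rotation[OF assms]; rule iffs; assumption)
qed

end
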